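(* Let $\Gamma$ be an Abelian group and let $\mathcal B=\{C_1,\dots,C_r\}\subset\mathcal S(G)$ be a cyclomatic circuit set of a finite connected graph $G$. Then the following are equivalent: 1. $g^{\det\mathcal B}\ne e_\Gamma$ for all $g\in\Gamma\setminus\{e_\Gamma\}$. 2. $\mathcal B$ is a $\Gamma$-circuit generator.
   Context: Graphs are simple and undirected, $G=(V,E)$; $\vec E$ contains both arcs $xy,yx$ for every edge. A circuit $C=(x_1,\dots,x_n)$ is a simple closed walk (simple cycle, $n\ge3$); $\mathcal S(G)$ is the set of circuits. A gain function is a map $\phi:\vec E\to\Gamma$ with $\phi(xy)=\phi(yx)^{-1}$; it is balanced on $C$ if $\phi(x_1x_2)\cdots\phi(x_{n-1}x_n)\phi(x_nx_1)=e_\Gamma$. A set $\mathcal B$ of circuits is a $\Gamma$-circuit generator if every gain function $\phi:\vec E\to\Gamma$ balanced on all circuits in $\mathcal B$ is balanced on all circuits of $G$. A cyclomatic circuit set is a set $\mathcal B\subset\mathcal S(G)$ of size $r=|E|-|V|+1$ (the cyclomatic number). Determinant: fix a direction for each edge and each circuit. $M(\mathcal B,\mathbb Q)$ is the $|E|\times r$ matrix whose columns are the incidence vectors of the circuits of $\mathcal B$: the entry for edge $e$ and circuit $C$ is $1$ if $C$ traverses $e$ in its chosen direction, $-1$ if in the opposite direction, and $0$ if $e\notin C$. For a spanning tree $T$, $M(\mathcal B,\mathbb Q,T)$ is the $r\times r$ submatrix obtained by deleting the rows of the edges of $T$. Then $\det\mathcal B:=|\det M(\mathcal B,\mathbb Q,T)|$,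 a non-negative integer independent of the choice of $T$. *)

theory Defs
  imports
    "Graph_Theory.Pair_Digraph"
    "Graph_Theory.Digraph_Component"
    "HOL-Algebra.Group"
    "Jordan_Normal_Form.Determinant"
    "Jordan_Normal_Form.DL_Submatrix"
begin

text \<open>
  A finite simple graph is a \<^locale>\<open>pair_graph\<close>: a finite, loop-free, symmetric arc set without
  parallel arcs. Its arcs \<^term>\<open>parcs G\<close> contain both \<open>(x, y)\<close> and \<open>(y, x)\<close> for every edge
  \<open>{x, y}\<close>.
\<close>

definition edge_of :: "'a \<times> 'a \<Rightarrow> 'a set" where
  "edge_of a = {fst a, snd a}"

definition edges :: "'a pair_pre_digraph \<Rightarrow> 'a set set" where
  "edges G = edge_of ` parcs G"

text \<open>
  A circuit carries neither a starting point nor a direction, so it is represented by the edge set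
  of a simple closed walk; in a simple graph this set determines the walk up to rotation and
  reversal. The walks \<open>p\<close> with \<open>traverses G p C\<close> are the directed, rooted versions of \<open>C\<close>. The
  length bound is needed because \<^const>\<open>pre_digraph.cycle\<close> admits \<open>x, y, x\<close>.
\<close>

definition circuit_walk :: "'a pair_pre_digraph \<Rightarrow> ('a \<times> 'a) list \<Rightarrow> bool" where
  "circuit_walk G p \<longleftrightarrow> pre_digraph.cycle (with_proj G) p \<and> 3 \<le> length p"

definition traverses ::
    "'a pair_pre_digraph \<Rightarrow> ('a \<times> 'a) list \<Rightarrow> 'a set set \<Rightarrow> bool" where
  "traverses G p C \<longleftrightarrow> circuit_walk G p \<and> edge_of ` set p = C"

definition circuits :: "'a pair_pre_digraph \<Rightarrow> 'a set set set" where
  "circuits G = {C. \<exists>p. traverses G p C}"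

definition gain_function ::
    "('g, 'm) monoid_scheme \<Rightarrow> 'a pair_pre_digraph \<Rightarrow> ('a \<times> 'a \<Rightarrow> 'g) \<Rightarrow> bool" where
  "gain_function \<Gamma> G \<phi> \<longleftrightarrow>
     \<phi> \<in> parcs G \<rightarrow> carrier \<Gamma> \<and>
     (\<forall>x y. (x, y) \<in> parcs G \<longrightarrow> \<phi> (x, y) = inv\<^bsub>\<Gamma>\<^esub> \<phi> (y, x))"

definition walk_gain ::
    "('g, 'm) monoid_scheme \<Rightarrow> ('a \<times> 'a \<Rightarrow> 'g) \<Rightarrow> ('a \<times> 'a) list \<Rightarrow> 'g" where
  "walk_gain \<Gamma> \<phi> p = foldr (\<lambda>a g. \<phi> a \<otimes>\<^bsub>\<Gamma>\<^esub> g) p \<one>\<^bsub>\<Gamma>\<^esub>"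

text \<open>
  Rotating a closed walk conjugates its gain and reversing it inverts the gain, so it makes no
  difference whether one or all traversals of \<open>C\<close> are required to have trivial gain.
\<close>

definition balanced_on ::
    "('g, 'm) monoid_scheme \<Rightarrow> 'a pair_pre_digraph \<Rightarrow> ('a \<times> 'a \<Rightarrow> 'g) \<Rightarrow> 'a set set \<Rightarrow> bool" where
  "balanced_on \<Gamma> G \<phi> C \<longleftrightarrow> (\<forall>p. traverses G p C \<longrightarrow> walk_gain \<Gamma> \<phi> p = \<one>\<^bsub>\<Gamma>\<^esub>)"

definition circuit_generator ::
    "('g, 'm) monoid_scheme \<Rightarrow> 'a pair_pre_digraph \<Rightarrow> 'a set set set \<Rightarrow> bool" where
  "circuit_generator \<Gamma> G \<B> \<longleftrightarrow>
     \<B> \<subseteq> circuits G \<and>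
     (\<forall>\<phi>. gain_function \<Gamma> G \<phi> \<longrightarrow> (\<forall>C\<in>\<B>. balanced_on \<Gamma> G \<phi> C) \<longrightarrow>
          (\<forall>C\<in>circuits G. balanced_on \<Gamma> G \<phi> C))"

definition cyclomatic_number :: "'a pair_pre_digraph \<Rightarrow> int" where
  "cyclomatic_number G = int (card (edges G)) - int (card (pverts G)) + 1"

definition cyclomatic_circuit_set :: "'a pair_pre_digraph \<Rightarrow> 'a set set set \<Rightarrow> bool" where
  "cyclomatic_circuit_set G \<B> \<longleftrightarrow> \<B> \<subseteq> circuits G \<and> int (card \<B>) = cyclomatic_number G"

text \<open>
  The constant \<^const>\<open>Digraph_Component.spanning_tree\<close> only excludes directed cycles, including
  those of length two, and hence does not describe spanning trees of undirected graphs.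
\<close>

definition undirected_spanning_tree ::
    "'a pair_pre_digraph \<Rightarrow> 'a pair_pre_digraph \<Rightarrow> bool" where
  "undirected_spanning_tree T G \<longleftrightarrow>
     pair_graph T \<and> spanning (with_proj T) (with_proj G) \<and>
     Digraph_Component.connected (with_proj T) \<and> circuits T = {}"

definition edge_directions :: "'a pair_pre_digraph \<Rightarrow> ('a set \<Rightarrow> 'a \<times> 'a) \<Rightarrow> bool" where
  "edge_directions G \<delta> \<longleftrightarrow> (\<forall>e\<in>edges G. \<delta> e \<in> parcs G \<and> edge_of (\<delta> e) = e)"

definition circuit_directions ::
    "'a pair_pre_digraph \<Rightarrow> 'a set set set \<Rightarrow> ('a set set \<Rightarrow> ('a \<times> 'a) list) \<Rightarrow> bool" where
  "circuit_directions G \<B> \<gamma> \<longleftrightarrow> (\<forall>C\<in>\<B>. traverses G (\<gamma> C) C)"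

definition incidence :: "'a \<times> 'a \<Rightarrow> ('a \<times> 'a) list \<Rightarrow> rat" where
  "incidence a p = (if a \<in> set p then 1 else if prod.swap a \<in> set p then -1 else 0)"

text \<open>
  Rows follow the enumeration \<open>es\<close> of the edges, columns the enumeration \<open>Cs\<close> of the circuits.
\<close>

definition circuit_matrix ::
    "('a set \<Rightarrow> 'a \<times> 'a) \<Rightarrow> ('a set set \<Rightarrow> ('a \<times> 'a) list) \<Rightarrow>
     'a set list \<Rightarrow> 'a set set list \<Rightarrow> rat mat" where
  "circuit_matrix \<delta> \<gamma> es Cs =
     mat (length es) (length Cs) (\<lambda>(i, j). incidence (\<delta> (es ! i)) (\<gamma> (Cs ! j)))"

definition reduced_circuit_matrix ::
    "('a set \<Rightarrow> 'a \<times> 'a) \<Rightarrow> ('a set set \<Rightarrow> ('a \<times> 'a) list) \<Rightarrow>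
     'a set list \<Rightarrow> 'a set set list \<Rightarrow> 'a pair_pre_digraph \<Rightarrow> rat mat" where
  "reduced_circuit_matrix \<delta> \<gamma> es Cs T =
     submatrix (circuit_matrix \<delta> \<gamma> es Cs) {i. i < length es \<and> es ! i \<notin> edges T} UNIV"

text \<open>The floor only converts the type; see \<open>of_nat_circuit_det\<close>.\<close>

definition circuit_det ::
    "('a set \<Rightarrow> 'a \<times> 'a) \<Rightarrow> ('a set set \<Rightarrow> ('a \<times> 'a) list) \<Rightarrow>
     'a set list \<Rightarrow> 'a set set list \<Rightarrow> 'a pair_pre_digraph \<Rightarrow> nat" where
  "circuit_det \<delta> \<gamma> es Cs T =
     nat \<lfloor>\<bar>Determinant.det (reduced_circuit_matrix \<delta> \<gamma> es Cs T)\<bar>\<rfloor>"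

lemma det_in_Ints:
  assumes "\<And>i j. i < dim_row A \<Longrightarrow> j < dim_col A \<Longrightarrow> A $$ (i, j) \<in> \<int>"
  shows "Determinant.det (A :: rat mat) \<in> \<int>"
proof (cases "dim_row A = dim_col A")
  case True
  have "(\<Prod>i = 0..<dim_row A. A $$ (i, p i)) \<in> \<int>" if "p permutes {0..<dim_row A}" for p
  proof (rule Ints_prod)
    fix i assume "i \<in> {0..<dim_row A}"
    then show "A $$ (i, p i) \<in> \<int>"
      using assms[of i "p i"] True permutes_in_image[OF that, of i] by simp
  qed
  then show ?thesis
    unfolding Determinant.det_def
    by (auto intro!: Ints_sum Ints_mult)
next
  case False
  then show ?thesis by (simp add: Determinant.det_def)
qed

lemma of_nat_circuit_det:
  "of_nat (circuit_det \<delta> \<gamma> es Cs T)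
     = \<bar>Determinant.det (reduced_circuit_matrix \<delta> \<gamma> es Cs T)\<bar>"
proof -
  let ?I = "{i. i < length es \<and> es ! i \<notin> edges T}"
  have "Determinant.det (reduced_circuit_matrix \<delta> \<gamma> es Cs T) \<in> \<int>"
  proof (rule det_in_Ints)
    fix i j
    assume i: "i < dim_row (reduced_circuit_matrix \<delta> \<gamma> es Cs T)"
      and j: "j < dim_col (reduced_circuit_matrix \<delta> \<gamma> es Cs T)"
    have i': "i < card {i. i < length es \<and> i \<in> ?I}" and j': "j < length Cs"
      using i j by (simp_all add: reduced_circuit_matrix_def dim_submatrix circuit_matrix_def)
    have "pick ?I i \<in> ?I" using i' by (intro pick_in_set_le) simp
    moreover have "pick UNIV j = j" by (rule pick_UNIV)
    ultimately show "reduced_circuit_matrix \<delta> \<gamma> es Cs T $$ (i, j) \<in> \<int>"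
      using i' j'
      by (simp add: reduced_circuit_matrix_def submatrix_def circuit_matrix_def incidence_def)
  qed
  then show ?thesis unfolding circuit_det_def by (auto elim!: Ints_cases)
qed

end

theory Submission
  imports Defs "HOL-Algebra.Multiplicative_Group"
begin

text \<open>
  Encode a walk by its net flow, the integer function counting how often each arc is used minus how
  often its reverse is used. In an Abelian group the gain of a walk depends on its flow only:
  it is the product over all edges \<open>e\<close> of \<open>\<phi> (\<delta> e)\<close> raised to the flow through \<open>\<delta> e\<close>
  (\<open>walk_gain_eq_finprod_flow\<close>), so it is a homomorphism in the flow. The flows of closed
  walks are circulations, and a circulation is determined by its values on the chords, the edges
  outside \<open>T\<close>: one that vanishes there lives on a graph without circuits and is zero
  (\<open>circulation_eq_0_if_no_circuit\<close>). There are as many chords as circuits in \<open>\<B>\<close>, and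
  the values of these circuits on the chords form a square integer matrix \<open>M\<close> with
  \<open>\<bar>det M\<bar> = det \<B>\<close>.

  Suppose that no nontrivial element of \<open>\<Gamma>\<close> is killed by \<open>det M\<close>. Cramer's rule writes
  \<open>det M\<close> times the flow of any circuit \<open>D\<close> as an integer combination of the flows of the members
  of \<open>\<B>\<close>, first on the chords and hence everywhere. If a gain function is balanced on \<open>\<B>\<close>, the
  gain of \<open>D\<close> therefore becomes trivial when raised to the power \<open>det M\<close>, so it is trivial.

  Conversely, let \<open>g\<close> be nontrivial with \<open>g ^ det M = 1\<close>, and let \<open>m\<close> be the order of \<open>g\<close>
  (zero if infinite), so that \<open>m\<close> divides \<open>det M\<close> but is no unit. A matrix whose determinant
  vanishes modulo \<open>m\<close> has a kernel vector that is nonzero modulo \<open>m\<close>, even though the integers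
  modulo \<open>m\<close> need not be a field; this is McCoy's theorem (\<open>exists_kernel_vector_mod\<close>). Such a
  vector \<open>c\<close> for the transpose of \<open>M\<close> yields the gain function that is \<open>g ^ c e\<close> on each chord
  \<open>e\<close> and trivial on \<open>T\<close>. It is balanced on \<open>\<B>\<close>, but not on the circuit that a chord \<open>e\<close>
  with \<open>g ^ c e \<noteq> 1\<close> closes with a path in \<open>T\<close>.
\<close>

section \<open>Kernel vectors of matrices over commutative rings\<close>

text \<open>
  A kernel vector is read off from a maximal minor of some first columns that survives modulo
  \<open>m\<close>, while those with one more column all vanish. Border it with that column and with the
  entries of row \<open>i\<close>: by Laplace expansion along the new
  row, the bordered minor is the product of row \<open>i\<close> with a vector of cofactors that does not
  depend on \<open>i\<close>. The bordered minors all vanish modulo \<open>m\<close>, while the last of the cofactors is the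
  surviving minor. The rows of a minor are chosen by a function \<open>f\<close> that may repeat rows, so that a row
  already present needs no separate treatment.
\<close>

lemma exists_kernel_vector_mod_if_minors_dvd:
  fixes a :: "nat \<Rightarrow> nat \<Rightarrow> 'a :: comm_ring_1"
  assumes "\<not> m dvd 1"
    and "\<And>f. (\<forall>k<n. f k < r) \<Longrightarrow> m dvd Determinant.det (mat n n (\<lambda>(k, j). a (f k) j))"
  shows "\<exists>c. (\<exists>j<n. \<not> m dvd c j) \<and> (\<forall>i<r. m dvd (\<Sum>j<n. a i j * c j))"
  using assms(2)
proof (induction n)
  case 0
  from 0[of "\<lambda>_. 0"] have "m dvd 1" by (simp add: det_dim_zero)
  with assms(1) show ?case by simp
next
  case (Suc n)
  let ?det = "\<lambda>f. Determinant.det (mat n n (\<lambda>(k, j). a (f k) j))"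
  show ?case
  \<comment> \<open>Either the first \<open>n\<close> columns suffice, or one of their maximal minors survives.\<close>
  proof (cases "\<forall>f. (\<forall>k<n. f k < r) \<longrightarrow> m dvd ?det f")
    case True
    then obtain c where "\<exists>j<n. \<not> m dvd c j" "\<forall>i<r. m dvd (\<Sum>j<n. a i j * c j)"
      using Suc.IH by blast
    then show ?thesis
      by (intro exI[of _ "c(n := 0)"]) (auto intro: less_SucI cong: sum.cong_simp)
  next
    case False
    then obtain f where f: "\<forall>k<n. f k < r" and minor: "\<not> m dvd ?det f" by blast
    define M where "M i = mat (Suc n) (Suc n) (\<lambda>(k, j). a (if k < n then f k else i) j)" for i
    define c where "c j = cofactor (M 0) n j" for j
    have cofactor: "cofactor (M i) n j = c j" if "j < Suc n" for i j
    proof -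
      have "mat_delete (M i) n j = mat_delete (M 0) n j"
        by (rule eq_matI) (auto simp: M_def mat_delete_def)
      then show ?thesis by (simp add: c_def cofactor_def)
    qed
    have "mat_delete (M 0) n n = mat n n (\<lambda>(k, j). a (f k) j)"
      by (rule eq_matI) (auto simp: M_def mat_delete_def)
    then have "c n = ?det f" by (simp add: c_def cofactor_def)
    moreover have "m dvd (\<Sum>j<Suc n. a i j * c j)" if "i < r" for i
    proof -
      have "M i \<in> carrier_mat (Suc n) (Suc n)" by (simp add: M_def)
      then have "Determinant.det (M i) = (\<Sum>j<Suc n. M i $$ (n, j) * cofactor (M i) n j)"
        by (rule laplace_expansion_row) simp
      also have "\<dots> = (\<Sum>j<Suc n. a i j * c j)"
      proof (rule sum.cong)
        fix j assume "j \<in> {..<Suc n}"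
        then have j: "j < Suc n" by simp
        then have "M i $$ (n, j) = a i j" by (simp add: M_def)
        then show "M i $$ (n, j) * cofactor (M i) n j = a i j * c j"
          using cofactor[OF j, of i] by simp
      qed simp
      finally show ?thesis
        using Suc.prems[of "\<lambda>k. if k < n then f k else i"] f that by (simp add: M_def)
    qed
    ultimately show ?thesis using minor by (intro exI[of _ c]) auto
  qed
qed

text \<open>
  Selecting rows of \<open>A\<close> amounts to multiplying by a 0-1 matrix from the left, so every maximal minor,
  repeated rows included, is a multiple of the determinant.
\<close>

lemma exists_kernel_vector_mod:
  fixes A :: "'a :: comm_ring_1 mat"
  assumes A: "A \<in> carrier_mat n n" and "m dvd Determinant.det A" and "\<not> m dvd 1"
  shows "\<exists>c. (\<exists>j<n. \<not> m dvd c j) \<and> (\<forall>i<n. m dvd (\<Sum>j<n. A $$ (i, j) * c j))"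
proof (rule exists_kernel_vector_mod_if_minors_dvd[OF assms(3)])
  fix f assume f: "\<forall>k<n. f k < n"
  define P where "P = mat n n (\<lambda>(k, i). if i = f k then 1 else 0 :: 'a)"
  have "mat n n (\<lambda>(k, j). A $$ (f k, j)) = P * A"
  proof (rule eq_matI)
    fix k j assume "k < dim_row (P * A)" "j < dim_col (P * A)"
    then have kj: "k < n" "j < n" using A by (auto simp: P_def)
    have "(P * A) $$ (k, j) = (\<Sum>i = 0..<n. (if i = f k then 1 else 0) * A $$ (i, j))"
      using A kj by (simp add: P_def scalar_prod_def del: sum.delta sum.delta' cong: sum.cong_simp)
    also have "\<dots> = (\<Sum>i = 0..<n. if i = f k then A $$ (i, j) else 0)"
      by (rule sum.cong) auto
    also have "\<dots> = A $$ (f k, j)" using f kj by simp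
    finally have entry: "(P * A) $$ (k, j) = A $$ (f k, j)" .
    show "mat n n (\<lambda>(k, j). A $$ (f k, j)) $$ (k, j) = (P * A) $$ (k, j)"
      unfolding entry using kj by simp
  qed (use A in \<open>auto simp: P_def\<close>)
  moreover have "Determinant.det (P * A) = Determinant.det P * Determinant.det A"
    using A by (intro det_mult) (auto simp: P_def)
  ultimately show "m dvd Determinant.det (mat n n (\<lambda>(k, j). A $$ (f k, j)))"
    using assms(2) by (simp add: dvd_mult)
qed

text \<open>
  Cramer's rule: the preimage of \<open>det A\<close> times \<open>d\<close> is the adjugate of \<open>A\<close> applied to \<open>d\<close>.
\<close>

lemma exists_preimage_of_det_multiple:
  fixes A :: "'a :: comm_ring_1 mat"
  assumes A: "A \<in> carrier_mat n n"
  shows "\<exists>k. \<forall>i<n. (\<Sum>j<n. A $$ (i, j) * k j) = Determinant.det A * d i"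
proof -
  have adj: "adj_mat A \<in> carrier_mat n n" using adj_mat(1)[OF A] .
  define k where "k j = (\<Sum>l<n. adj_mat A $$ (j, l) * d l)" for j
  have "(\<Sum>j<n. A $$ (i, j) * k j) = Determinant.det A * d i" if i: "i < n" for i
  proof -
    have entry: "(\<Sum>j<n. A $$ (i, j) * adj_mat A $$ (j, l)) = (if l = i then Determinant.det A else 0)"
      if "l < n" for l
    proof -
      have "(\<Sum>j<n. A $$ (i, j) * adj_mat A $$ (j, l)) = (A * adj_mat A) $$ (i, l)"
        using A adj i that by (auto simp: scalar_prod_def lessThan_atLeast0)
      then show ?thesis using i that by (auto simp: adj_mat(2)[OF A])
    qed
    have "(\<Sum>j<n. A $$ (i, j) * k j) = (\<Sum>l<n. \<Sum>j<n. A $$ (i, j) * adj_mat A $$ (j, l) * d l)"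
      unfolding k_def sum_distrib_left by (subst sum.swap) (simp add: mult.assoc)
    also have "\<dots> = (\<Sum>l<n. if l = i then Determinant.det A * d l else 0)"
      by (rule sum.cong) (auto simp: entry simp flip: sum_distrib_right)
    finally show ?thesis using i by simp
  qed
  then show ?thesis by blast
qed

section \<open>Circuits and trees\<close>

lemma edge_of_eq_iff: "edge_of a = edge_of b \<longleftrightarrow> a = b \<or> a = prod.swap b"
  by (cases a; cases b) (auto simp: edge_of_def doubleton_eq_iff)

lemma circuit_walk_mono:
  assumes "pverts H \<subseteq> pverts G" "parcs H \<subseteq> parcs G" "circuit_walk H p"
  shows "circuit_walk G p"
  using assms unfolding circuit_walk_def pre_digraph.cycle_def pre_digraph.awalk_def
  by (auto simp: cas_with_proj_eq awalk_verts_with_proj_eq)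

lemma (in pair_wf_digraph) circuit_walk_Cons_apath:
  assumes "(u, v) \<in> parcs G" "apath v p u" "2 \<le> length p"
  shows "circuit_walk G ((u, v) # p)"
proof -
  have "awalk u ((u, v) # p) u" "distinct (tl (awalk_verts u ((u, v) # p)))"
    using assms(1,2) by (auto simp: apath_def awalk_Cons_iff)
  then show ?thesis using assms(3) unfolding circuit_walk_def cycle_def by auto
qed

text \<open>
  Take a longest path in \<open>S\<close>. Its first vertex \<open>y\<close> has a neighbour \<open>w\<close> other than the second vertex of
  the path, and by maximality \<open>w\<close> lies on the path, which closes a circuit at \<open>w\<close>. This
  carries both facts about trees used below: a tree has a leaf, and it supports no nonzero
  circulation.
\<close>

lemma (in pair_digraph) exists_circuit_if_no_dead_end:
  assumes "S \<subseteq> parcs G" "S \<noteq> {}" and sym: "\<And>u v. (u, v) \<in> S \<Longrightarrow> (v, u) \<in> S"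
    and no_dead_end: "\<And>u v. (u, v) \<in> S \<Longrightarrow> \<exists>w. w \<noteq> u \<and> (v, w) \<in> S"
  shows "\<exists>p. circuit_walk G p"
proof -
  define P where "P p \<longleftrightarrow> p \<noteq> [] \<and> set p \<subseteq> S \<and> (\<exists>u v. apath u p v)" for p
  obtain x y where xy: "(x, y) \<in> S" using assms(2) by auto
  then have "x \<noteq> y" "(x, y) \<in> parcs G" using assms(1) pair_no_loops by force+
  then have "P [(x, y)]"
    using xy by (auto simp: P_def apath_Cons_iff apath_Nil_iff in_arcsD2 intro!: exI[of _ x] exI[of _ y])
  moreover have "\<forall>p. P p \<longrightarrow> length p < Suc (card (pverts G))"
    using length_apath by (auto simp: P_def less_Suc_eq_le)
  ultimately obtain p where "P p" and longest: "\<And>q. P q \<Longrightarrow> length q \<le> length p"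
    using ex_has_greatest_nat[of P "[(x, y)]" length] by blast
  then obtain y x p' v where p: "p = (y, x) # p'" "apath y p v" and pS: "set p \<subseteq> S"
    by (cases p) (auto simp: P_def apath_Cons_iff)
  then have "(x, y) \<in> S" using sym by auto
  then obtain w where w: "w \<noteq> x" "(y, w) \<in> S" using no_dead_end by blast
  then have wy: "(w, y) \<in> S" "(w, y) \<in> parcs G" and "w \<noteq> y"
    using sym assms(1) pair_no_loops by force+
  have "w \<in> set (awalk_verts y p)"
  proof (rule ccontr)
    assume "w \<notin> set (awalk_verts y p)"
    then have "apath w ((w, y) # p) v" using p wy by (simp add: apath_Cons_iff)
    then have "P ((w, y) # p)" using wy pS by (auto simp: P_def)
    then show False using longest[of "(w, y) # p"] by simp
  qed
  then obtain q r where qr: "p = q @ r" "awalk y q w"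
    using awalk_decomp p(2) unfolding apath_def by blast
  then have q: "apath y q w" using p(2) apath_append_iff[of y q r v] by (auto simp: awlast_of_awalk)
  \<comment> \<open>This is where \<open>w \<noteq> x\<close> matters: the closed walk \<open>w, y, w\<close> would be no circuit.\<close>
  have "2 \<le> length q"
  proof (rule ccontr)
    assume "\<not> 2 \<le> length q"
    then consider "q = []" | a where "q = [a]" by (cases q; cases "tl q") auto
    then show False
      using qr p(1) \<open>w \<noteq> x\<close> \<open>w \<noteq> y\<close> by cases (auto simp: awalk_Cons_iff awalk_Nil_iff)
  qed
  then show ?thesis using circuit_walk_Cons_apath[OF wy(2) q] by blast
qed

text \<open>
  Induction on the number of vertices, removing a leaf \<open>v\<close> together with the only edge at \<open>v\<close>.
\<close>

lemma card_edges_of_tree: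
  assumes "pair_graph T" "pverts T \<noteq> {}"
    and "\<And>u w. u \<in> pverts T \<Longrightarrow> w \<in> pverts T \<Longrightarrow> (u, w) \<in> (parcs T)\<^sup>*"
    and "\<And>p. \<not> circuit_walk T p"
  shows "card (edges T) + 1 = card (pverts T)"
  using assms
proof (induction "card (pverts T)" arbitrary: T rule: less_induct)
  case less
  interpret T: pair_graph T by fact
  show ?case
  proof (cases "parcs T = {}")
    case True
    then have "u = w" if "u \<in> pverts T" "w \<in> pverts T" for u w
      using less.prems(3)[OF that] by simp
    then obtain v where "pverts T = {v}" using less.prems(2) by blast
    then show ?thesis using True by (simp add: edges_def)
  next
    case False
    then obtain u v where uv: "(u, v) \<in> parcs T" and leaf: "\<And>w. (v, w) \<in> parcs T \<Longrightarrow> w = u"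
      using T.exists_circuit_if_no_dead_end[of "parcs T"] less.prems(4) T.arcs_symmetric by blast
    have vu: "(v, u) \<in> parcs T" and "u \<noteq> v" using uv T.arcs_symmetric T.pair_no_loops by force+
    have leaf': "w = u" if "(w, v) \<in> parcs T" for w using leaf that T.arcs_symmetric by blast
    define T' where "T' = \<lparr>pverts = pverts T - {v}, parcs = parcs T - {(u, v), (v, u)}\<rparr>"
    have T'_simps [simp]: "pverts T' = pverts T - {v}" "parcs T' = parcs T - {(u, v), (v, u)}"
      by (auto simp: T'_def)
    have verts: "u \<in> pverts T" "v \<in> pverts T" using uv T.in_arcsD1 T.in_arcsD2 by auto
    have card_less: "card (pverts T') < card (pverts T)"
      using card_Diff1_less[OF T.pair_finite_verts verts(2)] by simp
    have "pair_graph T'"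
    proof
      fix e assume "e \<in> parcs T'"
      then obtain x y where e: "e = (x, y)" "(x, y) \<in> parcs T" "(x, y) \<noteq> (u, v)" "(x, y) \<noteq> (v, u)"
        by (cases e) auto
      then have "x \<noteq> v" "y \<noteq> v" using leaf leaf' by blast+
      then show "fst e \<in> pverts T'" "snd e \<in> pverts T'"
        using e T.in_arcsD1 T.in_arcsD2 by auto
      show "fst e \<noteq> snd e" using e T.pair_no_loops by force
    next
      show "symmetric (with_proj T')"
        using T.arcs_symmetric by (auto simp: symmetric_def intro!: symI)
    qed (use T.pair_finite_verts T.pair_finite_arcs in simp_all)
    moreover have "pverts T' \<noteq> {}" using verts \<open>u \<noteq> v\<close> by auto
    moreover have "(x, y) \<in> (parcs T')\<^sup>*" if "x \<in> pverts T'" "y \<in> pverts T'" for x y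
    proof -
      \<comment> \<open>Walks survive the removal once they are projected by moving \<open>v\<close> onto its neighbour \<open>u\<close>.\<close>
      define \<pi> where "\<pi> z = (if z = v then u else z)" for z
      have "(\<pi> x, \<pi> y) \<in> (parcs T')\<^sup>*" if "(x, y) \<in> (parcs T)\<^sup>*" for x y
        using that
      proof (induction rule: rtrancl_induct)
        case (step y z)
        then have "\<pi> y = \<pi> z \<or> (\<pi> y, \<pi> z) \<in> parcs T'"
          using leaf leaf' by (auto simp: \<pi>_def)
        with step.IH show ?case by (auto intro: rtrancl_into_rtrancl)
      qed simp
      from this[of x y] show ?thesis using that less.prems(3)[of x y] by (simp add: \<pi>_def)
    qed
    moreover have "\<not> circuit_walk T' p" for p
      using less.prems(4)[of p] circuit_walk_mono[of T' T p] by auto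
    ultimately have IH: "card (edges T') + 1 = card (pverts T')"
      using less.hyps[OF card_less] by blast
    have edges_T: "edges T = insert {u, v} (edges T')" 
    proof -
      have "parcs T = insert (u, v) (insert (v, u) (parcs T'))" using uv vu by auto
      then have "edges T = edge_of ` insert (u, v) (insert (v, u) (parcs T'))"
        unfolding edges_def by (rule arg_cong)
      also have "\<dots> = insert {u, v} (edges T')"
        by (simp add: edges_def edge_of_def insert_commute)
      finally show ?thesis .
    qed
    have new: "{u, v} \<notin> edges T'"
    proof
      assume "{u, v} \<in> edges T'"
      then obtain a where "a \<in> parcs T'" "edge_of a = edge_of (u, v)"
        unfolding edges_def edge_of_def by force
      then show False by (simp add: edge_of_eq_iff)
    qed
    have "finite (edges T')" using T.pair_finite_arcs by (simp add: edges_def)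
    then have "card (edges T) = card (edges T') + 1"
      unfolding edges_T using new by (subst card_insert_disjoint) auto
    moreover have "card (pverts T) = card (pverts T') + 1"
      using card_Suc_Diff1[OF T.pair_finite_verts verts(2)] by simp
    ultimately show ?thesis using IH by simp
  qed
qed

lemma (in pair_sym_digraph) connected_verts:
  assumes "Digraph_Component.connected (with_proj G)" "u \<in> pverts G" "w \<in> pverts G"
  shows "(u, w) \<in> (parcs G)\<^sup>*" "\<exists>p. apath u p w"
proof -
  have *: "u \<rightarrow>\<^sup>*\<^bsub>with_proj G\<^esub> w"
    using assms reachable_mk_symmetric_eq[OF sym_arcs]
    unfolding Digraph_Component.connected_def strongly_connected_def by simp
  then show "(u, w) \<in> (parcs G)\<^sup>*"
    unfolding reachable_def by (simp add: rtrancl_on_rtranclI)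
  from * show "\<exists>p. apath u p w" by (simp add: reachable_apath)
qed

section \<open>Flows of walks and circulations\<close>

definition flow :: "('a \<times> 'a) list \<Rightarrow> 'a \<times> 'a \<Rightarrow> int" where
  "flow p a = int (count_list p a) - int (count_list p (prod.swap a))"

lemma flow_Nil [simp]: "flow [] a = 0"
  by (simp add: flow_def)

lemma flow_Cons: "flow (b # p) a = flow p a + (of_bool (b = a) - of_bool (b = prod.swap a))"
  by (simp add: flow_def)

lemma flow_swap: "flow p (prod.swap a) = - flow p a"
  by (simp add: flow_def)

text \<open>
  The definition of a cycle makes the heads of its arcs distinct; since the walk is closed, its tails
  are a rotation of its heads.
\<close>

lemma (in pair_wf_digraph) circuit_walk_structure:
  assumes "circuit_walk G p"
  obtains u where "awalk u p u" "distinct (map fst p)" "distinct (map snd p)" "3 \<le> length p"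
proof -
  from assms have "cycle p" and len: "3 \<le> length p" by (simp_all add: circuit_walk_def)
  then obtain u where u: "awalk u p u" "distinct (tl (awalk_verts u p))" "p \<noteq> []"
    unfolding cycle_def by (elim exE conjE)
  have tails: "awalk_verts u p = map fst p @ [snd (last p)]"
    and heads: "awalk_verts u p = fst (hd p) # map snd p"
    using awalk_verts_conv[of u p] awalk_verts_conv'[of u p u] u(1,3) by (simp_all add: awalk_def)
  have "hd (awalk_verts u p) = u" "last (awalk_verts u p) = u"
    using awends_of_awalk[OF u(1)] by simp_all
  then have "fst (hd p) = u" "snd (last p) = u"
    by (metis heads list.sel(1), metis tails last_snoc)
  then have eq: "map fst p @ [u] = u # map snd p" and "tl (awalk_verts u p) = map snd p"
    using tails heads by (metis, metis list.sel(3))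
  then have "distinct (map snd p)" using u(2) by simp
  moreover have "mset (map fst p) = mset (map snd p)"
    using arg_cong[OF eq, of mset] by simp
  ultimately have "distinct (map fst p)" by (metis mset_eq_imp_distinct_iff)
  then show ?thesis using that[OF u(1)] \<open>distinct (map snd p)\<close> len by blast
qed

text \<open>
  If the reverse of \<open>a\<close> occurred as well, it would be the only arc leaving the head of \<open>a\<close>, so the
  walk would take it right after \<open>a\<close>; being back at the tail of \<open>a\<close>, it could only stop. Its
  length would be two.
\<close>

lemma (in pair_loopfree_digraph) swap_notin_circuit_walk:
  assumes "circuit_walk G p" "a \<in> set p"
  shows "prod.swap a \<notin> set p"
proof
  assume swap: "prod.swap a \<in> set p"
  from assms(1) obtain u where u: "awalk u p u" "distinct (map fst p)" "3 \<le> length p"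
    by (rule circuit_walk_structure)
  from assms(2) obtain q1 q2 where p: "p = q1 @ a # q2" by (meson split_list)
  \<comment> \<open>Rotate the closed walk so that it starts with \<open>a\<close>.\<close>
  define q where "q = q2 @ q1"
  have walk: "awalk (snd a) q (fst a)" and "a \<in> parcs G"
    using u(1) unfolding p q_def by (auto simp: awalk_Cons_iff intro: awalk_appendI)
  have dist: "distinct (map fst (a # q))" using u(2) by (auto simp: p q_def)
  have "prod.swap a \<in> set q" using swap pair_no_loops[OF \<open>a \<in> parcs G\<close>]
    by (auto simp: p q_def prod_eq_iff)
  then obtain b q' where q: "q = b # q'" by (cases q) auto
  have "b = prod.swap a"
  proof (rule ccontr)
    assume "b \<noteq> prod.swap a"
    then have "prod.swap a \<in> set q'" using \<open>prod.swap a \<in> set q\<close> q by simp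
    then have "fst (prod.swap a) \<in> fst ` set q'" by (rule imageI)
    then have "snd a \<in> fst ` set q'" by simp
    then show False using dist walk by (auto simp: q awalk_Cons_iff)
  qed
  then have "awalk (fst a) q' (fst a)" using walk by (simp add: q awalk_Cons_iff)
  then have "q' = []" using dist by (cases q') (auto simp: q awalk_Cons_iff)
  then have "length p = 2" using arg_cong[OF q, of length] by (simp add: p q_def)
  then show False using u(3) by simp
qed

lemma (in pair_loopfree_digraph) flow_circuit_walk:
  assumes "circuit_walk G p"
  shows "flow p a = (if a \<in> set p then 1 else if prod.swap a \<in> set p then -1 else 0)"
proof -
  have "distinct p" using assms by (auto elim: circuit_walk_structure simp: distinct_map)
  then have "count_list p b = of_bool (b \<in> set p)" for b
    by (induction p) auto
  then show ?thesis using swap_notin_circuit_walk[OF assms, of a] by (simp add: flow_def)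
qed

lemma (in pair_loopfree_digraph) incidence_eq_flow:
  assumes "circuit_walk G p"
  shows "incidence a p = of_int (flow p a)"
  by (simp add: flow_circuit_walk[OF assms] incidence_def)

text \<open>
  The integral cycle space of \<open>G\<close>, as antisymmetric functions on arcs without net outflow at any
  vertex. Functions on all pairs, zero off the arcs, allow the same \<open>h\<close> to be viewed in a spanning
  subgraph.
\<close>

definition circulation :: "'a pair_pre_digraph \<Rightarrow> ('a \<times> 'a \<Rightarrow> int) \<Rightarrow> bool" where
  "circulation G h \<longleftrightarrow>
     (\<forall>a. h (prod.swap a) = - h a) \<and> (\<forall>a. a \<notin> parcs G \<longrightarrow> h a = 0) \<and>
     (\<forall>v. (\<Sum>w\<in>pverts G. h (v, w)) = 0)"

lemma circulationI:
  assumes "\<And>a. h (prod.swap a) = - h a" "\<And>a. a \<notin> parcs G \<Longrightarrow> h a = 0"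
    and "\<And>v. (\<Sum>w\<in>pverts G. h (v, w)) = 0"
  shows "circulation G h"
  using assms unfolding circulation_def by blast

lemma circulationD:
  assumes "circulation G h"
  shows "h (prod.swap a) = - h a" "a \<notin> parcs G \<Longrightarrow> h a = 0" "(\<Sum>w\<in>pverts G. h (v, w)) = 0"
  using assms unfolding circulation_def by blast+

lemma circulation_diff_mult:
  assumes f: "circulation G f" and g: "circulation G g"
  shows "circulation G (\<lambda>a. c * f a - g a)"
proof (rule circulationI)
  fix v
  have "(\<Sum>w\<in>pverts G. c * f (v, w) - g (v, w))
      = c * (\<Sum>w\<in>pverts G. f (v, w)) - (\<Sum>w\<in>pverts G. g (v, w))"
    by (simp only: sum_subtractf sum_distrib_left)
  then show "(\<Sum>w\<in>pverts G. c * f (v, w) - g (v, w)) = 0"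
    using circulationD(3)[OF f, of v] circulationD(3)[OF g, of v] by simp
next
  fix a
  show "c * f (prod.swap a) - g (prod.swap a) = - (c * f a - g a)"
    by (simp add: circulationD(1)[OF f] circulationD(1)[OF g])
  show "c * f a - g a = 0" if "a \<notin> parcs G"
    using circulationD(2)[OF f that] circulationD(2)[OF g that] by simp
qed

lemma circulation_sum:
  assumes f: "\<And>j. j \<in> J \<Longrightarrow> circulation G (f j)"
  shows "circulation G (\<lambda>a. \<Sum>j\<in>J. c j * f j a)"
proof (rule circulationI)
  fix v
  have "(\<Sum>w\<in>pverts G. \<Sum>j\<in>J. c j * f j (v, w)) = (\<Sum>j\<in>J. c j * (\<Sum>w\<in>pverts G. f j (v, w)))"
    by (subst sum.swap) (simp only: sum_distrib_left)
  also have "\<dots> = 0" by (rule sum.neutral) (simp add: circulationD(3)[OF f])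
  finally show "(\<Sum>w\<in>pverts G. \<Sum>j\<in>J. c j * f j (v, w)) = 0" .
next
  fix a
  have "(\<Sum>j\<in>J. c j * f j (prod.swap a)) = (\<Sum>j\<in>J. - (c j * f j a))"
    by (rule sum.cong) (simp_all add: circulationD(1)[OF f])
  then show "(\<Sum>j\<in>J. c j * f j (prod.swap a)) = - (\<Sum>j\<in>J. c j * f j a)"
    by (simp only: sum_negf)
  show "(\<Sum>j\<in>J. c j * f j a) = 0" if "a \<notin> parcs G"
    by (rule sum.neutral) (simp add: circulationD(2)[OF f that])
qed

lemma (in pair_pseudo_graph) sum_flow_awalk:
  assumes "awalk u p w"
  shows "(\<Sum>y\<in>pverts G. flow p (v, y)) = of_bool (v = u) - of_bool (v = w)"
  using assms
proof (induction p arbitrary: u)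
  case (Cons b p)
  have b: "fst b = u" "fst b \<in> pverts G" "snd b \<in> pverts G" "awalk (snd b) p w"
    using Cons.prems arc_fst_in_verts arc_snd_in_verts by (auto simp: awalk_Cons_iff)
  have "(\<Sum>y\<in>pverts G. of_bool (b = (v, y)) :: int) = of_bool (v = fst b)"
    "(\<Sum>y\<in>pverts G. of_bool (b = (y, v)) :: int) = of_bool (v = snd b)"
    using b pair_finite_verts by (cases b; auto simp: of_bool_def)+
  then show ?case using Cons.IH[OF b(4)] b(1)
    by (simp add: flow_Cons sum.distrib sum_subtractf)
qed (simp add: awalk_Nil_iff)

lemma (in pair_pseudo_graph) circulation_flow:
  assumes "awalk u p u"
  shows "circulation G (flow p)"
proof -
  have p: "set p \<subseteq> parcs G" using assms by (simp add: awalk_def)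
  have "flow p a = 0" if "a \<notin> parcs G" for a
  proof -
    have "prod.swap a \<notin> parcs G"
      using that arcs_symmetric[of "snd a" "fst a"] by (cases a) auto
    then have "count_list p a = 0" "count_list p (prod.swap a) = 0"
      using that p by (auto simp: count_list_0_iff)
    then show ?thesis by (simp add: flow_def)
  qed
  then show ?thesis using sum_flow_awalk[OF assms] by (intro circulationI) (simp_all add: flow_swap)
qed

text \<open>
  Whatever flows into a vertex must leave it by another arc, so the support of a nonzero circulation
  has no dead ends and contains a circuit.
\<close>

lemma (in pair_graph) circulation_eq_0_if_no_circuit:
  assumes "circulation G h" "\<And>p. \<not> circuit_walk G p"
  shows "h a = 0"
proof -
  let ?S = "{a. h a \<noteq> 0}"
  have swap: "h (v, u) = - h (u, v)" for u v
    using circulationD(1)[OF assms(1), of "(u, v)"] by simp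
  have supp: "?S \<subseteq> parcs G" and div: "(\<Sum>w\<in>pverts G. h (v, w)) = 0" for v
    using circulationD(2,3)[OF assms(1)] by blast+
  have "\<exists>w. w \<noteq> u \<and> (v, w) \<in> ?S" if "(u, v) \<in> ?S" for u v
  proof (rule ccontr)
    assume "\<not> ?thesis"
    then have zero: "h (v, w) = 0" if "w \<noteq> u" for w using that by auto
    have "u \<in> pverts G" using that supp in_arcsD1 by blast
    then have "(\<Sum>w\<in>pverts G. h (v, w)) = h (v, u) + (\<Sum>w\<in>pverts G - {u}. h (v, w))"
      using pair_finite_verts by (simp add: sum.remove)
    then show False using div[of v] that zero swap[of v u] by simp
  qed
  moreover have "(v, u) \<in> ?S" if "(u, v) \<in> ?S" for u v
    using that swap[of u v] by simp
  ultimately have "?S = {}"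
    using exists_circuit_if_no_dead_end[OF supp] assms(2) by blast
  then show ?thesis by blast
qed

lemma circulation_restrict:
  assumes h: "circulation G h" and verts: "pverts H = pverts G"
    and supp: "\<And>a. a \<notin> parcs H \<Longrightarrow> h a = 0"
  shows "circulation H h"
proof (rule circulationI)
  fix v
  show "(\<Sum>w\<in>pverts H. h (v, w)) = 0"
    unfolding verts by (rule circulationD(3)[OF h])
qed (rule circulationD(1)[OF h], rule supp)

lemma pcas_nth: "pcas u p v \<Longrightarrow> Suc i < length p \<Longrightarrow> snd (p ! i) = fst (p ! Suc i)"
proof (induction p arbitrary: u i)
  case (Cons e p)
  then show ?case by (cases i; cases p) auto
qed simp

text \<open>
  At each vertex of the circuit only the incoming and the outgoing arc carry flow, so conservation
  makes the two values agree.
\<close>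

lemma (in pair_graph) circulation_const_on_circuit:
  assumes h: "circulation G h" and p: "circuit_walk G p"
    and supp: "\<And>a. h a \<noteq> 0 \<Longrightarrow> a \<in> set p \<or> prod.swap a \<in> set p"
    and "i < length p"
  shows "h (p ! i) = h (p ! 0)"
  using \<open>i < length p\<close>
proof (induction i)
  case (Suc i)
  from p obtain u where u: "awalk u p u" "distinct (map fst p)" "distinct (map snd p)"
    by (rule circuit_walk_structure)
  obtain x y z where xy: "p ! i = (x, y)" and yz: "p ! Suc i = (y, z)"
    using pcas_nth[of u p u i] u(1) Suc.prems by (metis prod.collapse awalk_def)
  have mem: "(x, y) \<in> set p" "(y, z) \<in> set p"
    using Suc.prems xy yz by (metis nth_mem Suc_lessD)+
  then have "x \<noteq> z" using swap_notin_circuit_walk[OF p] by fastforce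
  have verts: "x \<in> pverts G" "z \<in> pverts G" using mem u(1) in_arcsD1 in_arcsD2 by blast+
  have "h (y, w) = 0" if "w \<noteq> x" "w \<noteq> z" for w
  proof (rule ccontr)
    assume "h (y, w) \<noteq> 0"
    then have "(y, w) \<in> set p \<or> (w, y) \<in> set p" using supp[of "(y, w)"] by simp
    then show False
    proof
      assume "(y, w) \<in> set p"
      then have "(y, w) = (y, z)"
        using inj_onD[of fst "set p" "(y, w)" "(y, z)"] u(2) mem(2) by (simp add: distinct_map)
      then show False using that by simp
    next
      assume "(w, y) \<in> set p"
      then have "(w, y) = (x, y)"
        using inj_onD[of snd "set p" "(w, y)" "(x, y)"] u(3) mem(1) by (simp add: distinct_map)
      then show False using that by simp
    qed
  qed
  then have "(\<Sum>w\<in>pverts G. h (y, w)) = (\<Sum>w\<in>{x, z}. h (y, w))"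
    using verts pair_finite_verts by (intro sum.mono_neutral_right) auto
  then have "h (y, x) + h (y, z) = 0"
    using circulationD(3)[OF h, of y] \<open>x \<noteq> z\<close> by simp
  moreover have "h (y, x) = - h (x, y)"
    using circulationD(1)[OF h, of "(x, y)"] by simp
  ultimately show ?case using Suc xy yz by simp
qed simp

text \<open>
  The gain of a circuit is only controlled along one chosen traversal. Any other traversal of
  the same edge set has a proportional flow: its flow is a circulation supported on the circuit and
  hence constant along the chosen traversal. So triviality of the gain passes from one
  traversal to all.
\<close>

lemma (in pair_graph) flow_eq_mult_if_same_circuit:
  assumes "traverses G p C" "traverses G q C"
  shows "\<exists>s. \<forall>a. flow q a = s * flow p a"
proof (intro exI allI)
  have p: "circuit_walk G p" and q: "circuit_walk G q" and C: "edge_of ` set p = edge_of ` set q"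
    using assms by (auto simp: traverses_def)
  have arc: "a \<in> set p \<or> prod.swap a \<in> set p" if "flow q a \<noteq> 0" for a
  proof -
    have "a \<in> set q \<or> prod.swap a \<in> set q" using that by (auto simp: flow_circuit_walk[OF q] split: if_splits)
    then have "edge_of a \<in> edge_of ` set q" by (metis edge_of_eq_iff imageI)
    then show ?thesis unfolding C[symmetric] by (auto simp: edge_of_eq_iff)
  qed
  from q obtain u where "awalk u q u" by (rule circuit_walk_structure)
  then have circ: "circulation G (flow q)" by (rule circulation_flow)
  have const: "flow q a = flow q (p ! 0)" if "a \<in> set p" for a
    using that circulation_const_on_circuit[OF circ p arc] by (auto simp: in_set_conv_nth)
  fix a
  show "flow q a = flow q (p ! 0) * flow p a"
    using arc[of a] const[of a] const[of "prod.swap a"] flow_swap[of q a]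
    by (auto simp: flow_circuit_walk[OF p])
qed

section \<open>Gains as functions of flows\<close>

lemma edge_directions_cases:
  assumes "edge_directions X \<delta>" "b \<in> parcs X"
  shows "b = \<delta> (edge_of b) \<or> b = prod.swap (\<delta> (edge_of b))"
proof -
  have "edge_of (\<delta> (edge_of b)) = edge_of b"
    using assms unfolding edge_directions_def edges_def by blast
  then show ?thesis by (metis edge_of_eq_iff)
qed

lemma (in comm_group) gain_function_swap:
  assumes "pair_graph X" "gain_function G X \<phi>" "a \<in> parcs X"
  shows "\<phi> a \<in> carrier G" "\<phi> (prod.swap a) = inv (\<phi> a)"
proof -
  interpret X: pair_graph X by fact
  show "\<phi> a \<in> carrier G" using assms by (auto simp: gain_function_def)
  have "(snd a, fst a) \<in> parcs X" using X.arcs_symmetric[of "fst a" "snd a"] assms(3) by simp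
  then have "\<phi> (snd a, fst a) = inv (\<phi> (fst a, snd a))"
    using assms(2) unfolding gain_function_def by blast
  then show "\<phi> (prod.swap a) = inv (\<phi> a)" by (cases a) simp
qed

text \<open>
  Prepending an arc \<open>b\<close> to the walk changes the exponent of a single factor, by \<open>1\<close> or \<open>-1\<close>
  according to whether \<open>b\<close> agrees with the direction of its edge; either way that factor is
  multiplied by \<open>\<phi> b\<close>.
\<close>

lemma (in comm_group) walk_gain_eq_finprod_flow:
  assumes X: "pair_graph X" and \<phi>: "gain_function G X \<phi>" and \<delta>: "edge_directions X \<delta>"
    and "set p \<subseteq> parcs X"
  shows "walk_gain G \<phi> p = (\<Otimes>e\<in>edges X. \<phi> (\<delta> e) [^] flow p (\<delta> e))"
  using assms(4)
proof (induction p)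
  case Nil
  then show ?case by (simp add: walk_gain_def)
next
  case (Cons b p)
  interpret X: pair_graph X by fact
  have closed: "\<phi> (\<delta> e) \<in> carrier G" if "e \<in> edges X" for e
    using that \<delta> gain_function_swap(1)[OF X \<phi>] by (auto simp: edge_directions_def)
  have fin: "finite (edges X)" using X.pair_finite_arcs by (simp add: edges_def)
  have b: "b \<in> parcs X" "edge_of b \<in> edges X" using Cons.prems by (auto simp: edges_def)
  \<comment> \<open>The change of the flow through \<open>\<delta> e\<close> caused by \<open>b\<close>.\<close>
  define \<epsilon> where "\<epsilon> e = (of_bool (b = \<delta> e) - of_bool (b = prod.swap (\<delta> e)) :: int)" for e
  have step: "\<phi> (\<delta> e) [^] \<epsilon> e = (if edge_of b = e then \<phi> b else \<one>)" if e: "e \<in> edges X" for e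
  proof (cases "edge_of b = e")
    case True
    have \<delta>e: "\<delta> e \<in> parcs X" using e \<delta> by (simp add: edge_directions_def)
    then have ne: "\<delta> e \<noteq> prod.swap (\<delta> e)" using X.pair_no_loops by (metis fst_swap)
    consider "b = \<delta> e" | "b = prod.swap (\<delta> e)"
      using edge_directions_cases[OF \<delta> b(1)] True by auto
    then show ?thesis
    proof cases
      case 1
      then show ?thesis using True ne closed[OF e] by (simp add: \<epsilon>_def)
    next
      case 2
      then have "\<epsilon> e = -1" using ne by (auto simp: \<epsilon>_def)
      then show ?thesis
        using True 2 gain_function_swap(2)[OF X \<phi> \<delta>e] closed[OF e] int_pow_neg[of "\<phi> (\<delta> e)" 1] by simp
    qed
  next
    case False
    have "edge_of (\<delta> e) = e" using e \<delta> by (simp add: edge_directions_def)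
    then have "b \<noteq> \<delta> e" "b \<noteq> prod.swap (\<delta> e)" using False by (metis edge_of_eq_iff)+
    then show ?thesis using False by (simp add: \<epsilon>_def)
  qed
  have "(\<Otimes>e\<in>edges X. \<phi> (\<delta> e) [^] flow (b # p) (\<delta> e))
      = (\<Otimes>e\<in>edges X. \<phi> (\<delta> e) [^] flow p (\<delta> e) \<otimes> \<phi> (\<delta> e) [^] \<epsilon> e)"
    using closed by (intro finprod_cong) (auto simp: flow_Cons \<epsilon>_def int_pow_mult)
  also have "\<dots> = (\<Otimes>e\<in>edges X. \<phi> (\<delta> e) [^] flow p (\<delta> e)) \<otimes> (\<Otimes>e\<in>edges X. \<phi> (\<delta> e) [^] \<epsilon> e)"
    using closed by (intro finprod_multf) auto
  also have "(\<Otimes>e\<in>edges X. \<phi> (\<delta> e) [^] \<epsilon> e) = (\<Otimes>e\<in>edges X. if edge_of b = e then \<phi> b else \<one>)"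
    using gain_function_swap(1)[OF X \<phi> b(1)] by (intro finprod_cong) (auto simp: step)
  also have "\<dots> = \<phi> b"
    using finprod_singleton[OF b(2) fin, of "\<lambda>_. \<phi> b"] gain_function_swap(1)[OF X \<phi> b(1)] by auto
  also have "(\<Otimes>e\<in>edges X. \<phi> (\<delta> e) [^] flow p (\<delta> e)) \<otimes> \<phi> b = \<phi> b \<otimes> walk_gain G \<phi> p"
    using Cons gain_function_swap(1)[OF X \<phi> b(1)] closed by (simp add: m_comm finprod_closed Pi_I)
  finally show ?case by (simp add: walk_gain_def)
qed

lemma (in comm_group) finprod_int_pow:
  assumes "finite E" "\<And>e. e \<in> E \<Longrightarrow> x e \<in> carrier G"
  shows "(\<Otimes>e\<in>E. x e [^] (k * f e :: int)) = (\<Otimes>e\<in>E. x e [^] f e) [^] k"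
  using assms
proof (induction E)
  case (insert a E)
  then have "(\<Otimes>e\<in>E. x e [^] (k * f e)) = (\<Otimes>e\<in>E. x e [^] f e) [^] k" by auto
  then show ?case
    using insert by (simp add: Pi_I int_pow_distrib int_pow_pow mult.commute)
qed simp

lemma (in comm_group) finprod_int_pow_sum_eq_one:
  assumes "finite E" "finite J" "\<And>e. e \<in> E \<Longrightarrow> x e \<in> carrier G"
    and one: "\<And>j. j \<in> J \<Longrightarrow> (\<Otimes>e\<in>E. x e [^] (f j e :: int)) = \<one>"
  shows "(\<Otimes>e\<in>E. x e [^] (\<Sum>j\<in>J. k j * f j e)) = \<one>"
  using assms(2,4)
proof (induction J)
  case (insert j J)
  have "(\<Otimes>e\<in>E. x e [^] (\<Sum>j\<in>insert j J. k j * f j e))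
      = (\<Otimes>e\<in>E. x e [^] (k j * f j e) \<otimes> x e [^] (\<Sum>j\<in>J. k j * f j e))"
    using insert.hyps assms(3) by (intro finprod_cong) (auto simp: int_pow_mult)
  also have "\<dots> = (\<Otimes>e\<in>E. x e [^] (k j * f j e)) \<otimes> (\<Otimes>e\<in>E. x e [^] (\<Sum>j\<in>J. k j * f j e))"
    using assms(3) by (intro finprod_multf) auto
  also have "\<dots> = \<one>"
    using insert finprod_int_pow[OF assms(1,3), where k = "k j" and f = "f j"] by simp
  finally show ?case .
qed simp

lemma (in comm_group) finprod_int_pow_const:
  assumes "g \<in> carrier G"
  shows "(\<Otimes>e\<in>E. g [^] (f e :: int)) = g [^] (\<Sum>e\<in>E. f e)"
proof (cases "finite E")
  case True
  then show ?thesis using assms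
    by (induction E) (auto simp: int_pow_mult Pi_I)
qed simp

section \<open>Circuit matrices and circuit generators\<close>

locale cyclomatic_circuits = G: pair_graph G + T: pair_graph T
  for G T :: "'a pair_pre_digraph" +
  fixes \<delta> :: "'a set \<Rightarrow> 'a \<times> 'a" and \<gamma> :: "'a set set \<Rightarrow> ('a \<times> 'a) list"
    and es :: "'a set list" and Cs :: "'a set set list"
  assumes cyclomatic: "cyclomatic_circuit_set G (set Cs)"
    and edge_directions: "edge_directions G \<delta>"
    and circuit_directions: "circuit_directions G (set Cs) \<gamma>"
    and distinct_es: "distinct es" and set_es: "set es = edges G"
    and distinct_Cs: "distinct Cs"
    and spanning_tree: "undirected_spanning_tree T G"
begin

definition chords :: "'a set list" where
  "chords = nths es {i. i < length es \<and> es ! i \<notin> edges T}"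

definition chord_matrix :: "int mat" where
  "chord_matrix = mat (length Cs) (length Cs) (\<lambda>(i, j). flow (\<gamma> (Cs ! j)) (\<delta> (chords ! i)))"

lemma pverts_T: "pverts T = pverts G" and parcs_T: "parcs T \<subseteq> parcs G"
  and connected_T: "Digraph_Component.connected (with_proj T)"
  using spanning_tree
  by (simp_all add: undirected_spanning_tree_def spanning_def Digraph_Component.subgraph_def)

lemma no_circuit_T: "\<not> circuit_walk T p"
proof
  assume "circuit_walk T p"
  then have "edge_of ` set p \<in> circuits T" by (auto simp: circuits_def traverses_def)
  then show False using spanning_tree by (simp add: undirected_spanning_tree_def)
qed

lemma finite_edges: "finite (edges G)"
  using G.pair_finite_arcs by (simp add: edges_def)

lemma edges_T: "edges T \<subseteq> edges G"
  using parcs_T by (auto simp: edges_def)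

lemma set_chords: "set chords = edges G - edges T"
  unfolding chords_def set_nths set_es[symmetric] by (auto simp: in_set_conv_nth)

lemma distinct_chords: "distinct chords"
  by (simp add: chords_def distinct_es distinct_nthsI)

text \<open>
  The matrix is square because a spanning tree has one edge less than the graph has vertices. The
  determinant of a non-square matrix is zero by convention, so this count is essential.
\<close>

lemma length_chords: "length chords = length Cs"
proof -
  have "pverts T \<noteq> {}"
    using connected_T by (auto simp: Digraph_Component.connected_def strongly_connected_def)
  then have tree: "card (edges T) + 1 = card (pverts G)"
    using T.connected_verts(1)[OF connected_T] no_circuit_T T.pair_graph
    unfolding pverts_T[symmetric] by (intro card_edges_of_tree) auto
  have le: "card (edges T) \<le> card (edges G)"
    using edges_T finite_edges by (intro card_mono)
  have "length chords = card (edges G - edges T)"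
    using distinct_card[OF distinct_chords] by (simp add: set_chords)
  also have "\<dots> = card (edges G) - card (edges T)"
    using edges_T finite_edges by (intro card_Diff_subset) (auto intro: finite_subset)
  finally have "length chords = card (edges G) - card (edges T)" .
  moreover have "int (length Cs) = int (card (edges G)) - int (card (pverts G)) + 1"
    using cyclomatic distinct_card[OF distinct_Cs]
    by (simp add: cyclomatic_circuit_set_def cyclomatic_number_def)
  ultimately show ?thesis using tree le by linarith
qed

lemma traverses_nth: "j < length Cs \<Longrightarrow> traverses G (\<gamma> (Cs ! j)) (Cs ! j)"
  using circuit_directions by (simp add: circuit_directions_def)

lemma circuit_det_eq: "circuit_det \<delta> \<gamma> es Cs T = nat \<bar>Determinant.det chord_matrix\<bar>"
proof -
  let ?I = "{i. i < length es \<and> es ! i \<notin> edges T}"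
  have len: "card {i. i < length es \<and> i \<in> ?I} = length Cs"
    unfolding length_chords[symmetric] chords_def length_nths by simp
  have "reduced_circuit_matrix \<delta> \<gamma> es Cs T = map_mat of_int chord_matrix"
  proof (rule eq_matI)
    fix i j assume "i < dim_row (map_mat of_int chord_matrix :: rat mat)"
      "j < dim_col (map_mat of_int chord_matrix :: rat mat)"
    then have ij: "i < length Cs" "j < length Cs" by (simp_all add: chord_matrix_def)
    have pick: "pick ?I i < length es" "es ! pick ?I i = chords ! i"
      using ij(1) len pick_in_set_le[of i ?I] nth_nths[of i es ?I] by (auto simp: chords_def)
    show "reduced_circuit_matrix \<delta> \<gamma> es Cs T $$ (i, j) = map_mat of_int chord_matrix $$ (i, j)"
      using ij len pick traverses_nth[OF ij(2)]
      by (simp add: reduced_circuit_matrix_def submatrix_def circuit_matrix_def chord_matrix_def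
          pick_UNIV G.incidence_eq_flow traverses_def)
  qed (use len in \<open>simp_all add: reduced_circuit_matrix_def dim_submatrix circuit_matrix_def chord_matrix_def\<close>)
  then have "Determinant.det (reduced_circuit_matrix \<delta> \<gamma> es Cs T) = of_int (Determinant.det chord_matrix)"
    by (simp add: of_int_hom.hom_det)
  then show ?thesis by (simp add: circuit_det_def flip: of_int_abs)
qed

text \<open>
  Up to the factor \<open>det M\<close>, the circuits in \<open>Cs\<close> span the cycle space over the integers. On the
  chords this is Cramer's rule; the difference of both sides is then a circulation of the tree.
\<close>

lemma det_multiple_of_circulation:
  assumes f: "circulation G f"
  shows "\<exists>k. \<forall>a. Determinant.det chord_matrix * f a = (\<Sum>j<length Cs. k j * flow (\<gamma> (Cs ! j)) a)"
proof -
  have M: "chord_matrix \<in> carrier_mat (length Cs) (length Cs)" by (simp add: chord_matrix_def)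
  obtain k where k: "\<And>i. i < length Cs \<Longrightarrow>
      (\<Sum>j<length Cs. chord_matrix $$ (i, j) * k j) = Determinant.det chord_matrix * f (\<delta> (chords ! i))"
    using exists_preimage_of_det_multiple[OF M, of "\<lambda>i. f (\<delta> (chords ! i))"] by blast
  define h where "h a = Determinant.det chord_matrix * f a
      - (\<Sum>j<length Cs. k j * flow (\<gamma> (Cs ! j)) a)" for a
  have "circulation G (flow (\<gamma> (Cs ! j)))" if "j < length Cs" for j
    using traverses_nth[OF that] G.circulation_flow by (auto simp: traverses_def elim: G.circuit_walk_structure)
  then have h: "circulation G h"
    unfolding h_def by (intro circulation_diff_mult f circulation_sum) simp
  have "h a = 0" if a: "a \<notin> parcs T" for a
  proof (cases "a \<in> parcs G")
    case True
    have "edge_of a \<notin> edges T"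
    proof
      assume "edge_of a \<in> edges T"
      then obtain b where "b \<in> parcs T" "edge_of a = edge_of b" by (auto simp: edges_def)
      then show False using a T.arcs_symmetric[of "fst b" "snd b"] by (auto simp: edge_of_eq_iff prod.swap_def)
    qed
    then have "edge_of a \<in> set chords" using True by (simp add: set_chords edges_def)
    then obtain i where i: "i < length Cs" "edge_of a = chords ! i"
      by (metis in_set_conv_nth length_chords)
    have "h (\<delta> (edge_of a)) = 0"
      using k[OF i(1)] i by (simp add: h_def chord_matrix_def mult.commute)
    then show ?thesis
      using edge_directions_cases[OF edge_directions True] circulationD(1)[OF h] by (metis neg_0_equal_iff_equal)
  qed (rule circulationD(2)[OF h])
  then have "circulation T h" by (intro circulation_restrict[OF h pverts_T])
  then have "h a = 0" for a using T.circulation_eq_0_if_no_circuit no_circuit_T by blast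
  then show ?thesis by (auto simp: h_def)
qed

lemma exists_circuit_through_chord:
  assumes "i < length Cs"
  shows "\<exists>p. circuit_walk G (\<delta> (chords ! i) # p) \<and> set p \<subseteq> parcs T"
proof -
  have e: "chords ! i \<in> edges G" "chords ! i \<notin> edges T"
    using assms set_chords nth_mem[of i chords] by (auto simp: length_chords)
  obtain u v where uv: "\<delta> (chords ! i) = (u, v)" by (cases "\<delta> (chords ! i)")
  have arc: "(u, v) \<in> parcs G" "edge_of (u, v) = chords ! i"
    using e edge_directions uv by (auto simp: edge_directions_def)
  then have "u \<noteq> v" "u \<in> pverts T" "v \<in> pverts T"
    using G.pair_no_loops G.in_arcsD1 G.in_arcsD2 by (force simp: pverts_T)+
  then obtain p where p: "T.apath v p u" using T.connected_verts(2)[OF connected_T] by blast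
  have "2 \<le> length p"
  proof (rule ccontr)
    assume "\<not> 2 \<le> length p"
    then consider "p = []" | b where "p = [b]" by (cases p; cases "tl p") auto
    then show False
    proof cases
      case 2
      then have "(v, u) \<in> parcs T" using p by (cases b) (auto simp: T.apath_Cons_iff T.apath_Nil_iff)
      moreover have "edge_of (v, u) = chords ! i" using arc(2) by (auto simp: edge_of_def)
      ultimately show False using e(2) by (auto simp: edges_def)
    qed (use p \<open>u \<noteq> v\<close> in \<open>simp add: T.apath_Nil_iff\<close>)
  qed
  moreover have "G.apath v p u" and "set p \<subseteq> parcs T"
    using p parcs_T pverts_T by (auto simp: T.apath_def G.apath_def T.awalk_def G.awalk_def)
  ultimately show ?thesis using G.circuit_walk_Cons_apath[OF arc(1)] uv by auto
qed

lemma circuit_generator_if_no_det_torsion: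
  fixes \<Gamma> (structure)
  assumes "comm_group \<Gamma>"
    and torsion: "\<And>g. g \<in> carrier \<Gamma> \<Longrightarrow> g [^] Determinant.det chord_matrix = \<one> \<Longrightarrow> g = \<one>"
  shows "circuit_generator \<Gamma> G (set Cs)"
  unfolding circuit_generator_def
proof (intro conjI allI impI ballI)
  interpret comm_group \<Gamma> by fact
  show "set Cs \<subseteq> circuits G" using cyclomatic by (simp add: cyclomatic_circuit_set_def)
  fix \<phi> D
  assume \<phi>: "gain_function \<Gamma> G \<phi>" and bal: "\<forall>C\<in>set Cs. balanced_on \<Gamma> G \<phi> C"
  have closed: "\<phi> (\<delta> e) \<in> carrier \<Gamma>" if "e \<in> edges G" for e
    using that edge_directions gain_function_swap(1)[OF G.pair_graph \<phi>] by (auto simp: edge_directions_def)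
  have gain: "walk_gain \<Gamma> \<phi> p = (\<Otimes>e\<in>edges G. \<phi> (\<delta> e) [^] flow p (\<delta> e))" if "G.awalk u p u" for u p
    using that by (intro walk_gain_eq_finprod_flow[OF G.pair_graph \<phi> edge_directions]) auto
  show "balanced_on \<Gamma> G \<phi> D"
    unfolding balanced_on_def
  proof (intro allI impI)
    fix p assume "traverses G p D"
    then obtain u where p: "G.awalk u p u" by (auto simp: traverses_def elim: G.circuit_walk_structure)
    obtain k where k: "\<And>a. Determinant.det chord_matrix * flow p a = (\<Sum>j<length Cs. k j * flow (\<gamma> (Cs ! j)) a)"
      using det_multiple_of_circulation[OF G.circulation_flow[OF p]] by blast
    have one: "(\<Otimes>e\<in>edges G. \<phi> (\<delta> e) [^] flow (\<gamma> (Cs ! j)) (\<delta> e)) = \<one>" if j: "j < length Cs" for j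
    proof -
      obtain u where "G.awalk u (\<gamma> (Cs ! j)) u"
        using traverses_nth[OF j] by (auto simp: traverses_def elim: G.circuit_walk_structure)
      moreover have "walk_gain \<Gamma> \<phi> (\<gamma> (Cs ! j)) = \<one>"
        using bal traverses_nth[OF j] nth_mem[OF j] unfolding balanced_on_def by blast
      ultimately show ?thesis using gain by simp
    qed
    have "walk_gain \<Gamma> \<phi> p [^] Determinant.det chord_matrix
        = (\<Otimes>e\<in>edges G. \<phi> (\<delta> e) [^] (Determinant.det chord_matrix * flow p (\<delta> e)))"
      using finprod_int_pow[OF finite_edges closed] gain[OF p] by simp
    also have "\<dots> = \<one>"
      unfolding k using finite_edges closed one by (intro finprod_int_pow_sum_eq_one) auto
    finally show "walk_gain \<Gamma> \<phi> p = \<one>"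
      using torsion gain[OF p] closed by (simp add: finprod_closed Pi_I)
  qed
qed

lemma not_circuit_generator_if_det_torsion:
  fixes \<Gamma> (structure)
  assumes "comm_group \<Gamma>" and g: "g \<in> carrier \<Gamma>" "g \<noteq> \<one>"
    and torsion: "g [^] Determinant.det chord_matrix = \<one>"
  shows "\<not> circuit_generator \<Gamma> G (set Cs)"
proof
  interpret comm_group \<Gamma> by fact
  assume generator: "circuit_generator \<Gamma> G (set Cs)"
  let ?r = "length Cs" and ?m = "int (ord g)"
  have pow_one: "g [^] z = \<one> \<longleftrightarrow> ?m dvd z" for z :: int using int_pow_eq_id[OF g(1)] .
  have "transpose_mat chord_matrix \<in> carrier_mat ?r ?r" by (simp add: chord_matrix_def)
  moreover have "?m dvd Determinant.det (transpose_mat chord_matrix)"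
    using torsion pow_one by (simp add: det_transpose[of _ ?r] chord_matrix_def)
  moreover have "\<not> ?m dvd 1" using g pow_one[of 1] by simp
  ultimately obtain c i\<^sub>0 where i\<^sub>0: "i\<^sub>0 < ?r" "\<not> ?m dvd c i\<^sub>0"
    and kernel: "\<And>j. j < ?r \<Longrightarrow> ?m dvd (\<Sum>i<?r. transpose_mat chord_matrix $$ (j, i) * c i)"
    using exists_kernel_vector_mod by blast
  \<comment> \<open>The kernel vector as a function on edges, zero on the tree.\<close>
  define val where "val e = (\<Sum>i<?r. if chords ! i = e then c i else 0)" for e
  have val_chord: "val (chords ! i) = c i" if "i < ?r" for i
  proof -
    have "(chords ! k = chords ! i) = (k = i)" if "k < ?r" for k
      using that \<open>i < ?r\<close> distinct_chords by (simp add: nth_eq_iff_index_eq length_chords)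
    then have "val (chords ! i) = (\<Sum>k<?r. if k = i then c k else 0)"
      unfolding val_def by (intro sum.cong) auto
    then show ?thesis using that by simp
  qed
  have val_tree: "val e = 0" if "e \<in> edges T" for e
    unfolding val_def using that set_chords nth_mem[of _ chords]
    by (intro sum.neutral) (auto simp: length_chords)
  \<comment> \<open>Its antisymmetric extension to arcs.\<close>
  define \<kappa> where "\<kappa> a = (if a = \<delta> (edge_of a) then val (edge_of a) else - val (edge_of a))" for a
  define \<phi> where "\<phi> a = g [^] \<kappa> a" for a
  have \<kappa>_\<delta>: "\<kappa> (\<delta> e) = val e" if "e \<in> edges G" for e
    using that edge_directions by (simp add: \<kappa>_def edge_directions_def)
  have "\<kappa> (x, y) = - \<kappa> (y, x)" if xy: "(x, y) \<in> parcs G" for x y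
  proof -
    have "x \<noteq> y" using G.pair_no_loops[OF xy] by simp
    have swap: "edge_of (y, x) = edge_of (x, y)" by (auto simp: edge_of_def)
    have "\<delta> (edge_of (x, y)) = (x, y) \<or> \<delta> (edge_of (x, y)) = (y, x)"
      using edge_directions_cases[OF edge_directions xy] by (metis swap_simp swap_swap)
    then show ?thesis using \<open>x \<noteq> y\<close> unfolding \<kappa>_def swap by auto
  qed
  then have gain_function: "gain_function \<Gamma> G \<phi>"
    using g(1) by (auto simp: gain_function_def \<phi>_def int_pow_neg)
  have gain: "walk_gain \<Gamma> \<phi> q = (\<Otimes>e\<in>edges G. \<phi> (\<delta> e) [^] flow q (\<delta> e))" if "circuit_walk G q" for q
    using that by (intro walk_gain_eq_finprod_flow[OF G.pair_graph gain_function edge_directions])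
      (auto elim!: G.circuit_walk_structure)
  have "balanced_on \<Gamma> G \<phi> (Cs ! j)" if j: "j < ?r" for j
    unfolding balanced_on_def
  proof (intro allI impI)
    fix q assume q: "traverses G q (Cs ! j)"
    let ?p = "\<gamma> (Cs ! j)"
    obtain s where s: "\<And>a. flow q a = s * flow ?p a"
      using G.flow_eq_mult_if_same_circuit[OF traverses_nth[OF j] q] by blast
    have "(\<Sum>e\<in>edges G. val e * flow ?p (\<delta> e)) = (\<Sum>e\<in>set chords. val e * flow ?p (\<delta> e))"
      using finite_edges by (intro sum.mono_neutral_right) (auto simp: set_chords val_tree)
    also have "\<dots> = (\<Sum>i<?r. val (chords ! i) * flow ?p (\<delta> (chords ! i)))"
      using bij_betw_nth[OF distinct_chords refl refl]
      by (intro sum.reindex_bij_betw[symmetric]) (simp add: length_chords)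
    also have "\<dots> = (\<Sum>i<?r. transpose_mat chord_matrix $$ (j, i) * c i)"
      using j by (intro sum.cong) (auto simp: val_chord chord_matrix_def)
    finally have "?m dvd (\<Sum>e\<in>edges G. val e * flow ?p (\<delta> e))" using kernel[OF j] by simp
    then have "?m dvd (\<Sum>e\<in>edges G. val e * flow q (\<delta> e))"
      by (simp add: s mult.left_commute flip: sum_distrib_left)
    then have "g [^] (\<Sum>e\<in>edges G. val e * flow q (\<delta> e)) = \<one>" by (simp add: pow_one)
    moreover have "walk_gain \<Gamma> \<phi> q = (\<Otimes>e\<in>edges G. g [^] (val e * flow q (\<delta> e)))"
      unfolding gain[OF q[unfolded traverses_def, THEN conjunct1]]
      using g(1) by (intro finprod_cong) (auto simp: \<phi>_def \<kappa>_\<delta> int_pow_pow)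
    ultimately show "walk_gain \<Gamma> \<phi> q = \<one>" by (simp add: finprod_int_pow_const[OF g(1)])
  qed
  then have "balanced_on \<Gamma> G \<phi> C" if "C \<in> set Cs" for C
    using that by (auto simp: in_set_conv_nth)
  then have all: "balanced_on \<Gamma> G \<phi> D" if "D \<in> circuits G" for D
    using generator gain_function that unfolding circuit_generator_def by blast
  \<comment> \<open>On this fundamental circuit, only its single chord contributes to the gain.\<close>
  obtain p where p: "circuit_walk G (\<delta> (chords ! i\<^sub>0) # p)" "set p \<subseteq> parcs T"
    using exists_circuit_through_chord[OF i\<^sub>0(1)] by blast
  have "\<phi> a = \<one>" if "a \<in> set p" for a
    using that p(2) val_tree[of "edge_of a"] by (auto simp: \<phi>_def \<kappa>_def edges_def)
  then have "walk_gain \<Gamma> \<phi> p = \<one>" by (induction p) (auto simp: walk_gain_def)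
  moreover have "chords ! i\<^sub>0 \<in> edges G"
    using i\<^sub>0(1) set_chords nth_mem[of i\<^sub>0 chords] by (auto simp: length_chords)
  ultimately have "walk_gain \<Gamma> \<phi> (\<delta> (chords ! i\<^sub>0) # p) = g [^] c i\<^sub>0"
    using i\<^sub>0(1) g(1) by (simp add: walk_gain_def \<phi>_def \<kappa>_\<delta> val_chord)
  moreover have "walk_gain \<Gamma> \<phi> (\<delta> (chords ! i\<^sub>0) # p) = \<one>"
    using all p(1) by (auto simp: circuits_def balanced_on_def traverses_def)
  ultimately have "g [^] c i\<^sub>0 = \<one>" by simp
  then show False using i\<^sub>0(2) pow_one by blast
qed

end

theorem corollary5p6:
  fixes \<Gamma> :: "('g, 'm) monoid_scheme"
    and G T :: "'a pair_pre_digraph"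
    and \<B> :: "'a set set set"
    and \<delta> :: "'a set \<Rightarrow> 'a \<times> 'a"
    and \<gamma> :: "'a set set \<Rightarrow> ('a \<times> 'a) list"
    and es :: "'a set list"
    and Cs :: "'a set set list"
  assumes "comm_group \<Gamma>"
    and "pair_graph G"
    and "Digraph_Component.connected (with_proj G)"
    and "cyclomatic_circuit_set G \<B>"
    and "edge_directions G \<delta>"
    and "circuit_directions G \<B> \<gamma>"
    and "distinct es" and "set es = edges G"
    and "distinct Cs" and "set Cs = \<B>"
    and "undirected_spanning_tree T G"
  shows "(\<forall>g \<in> carrier \<Gamma> - {\<one>\<^bsub>\<Gamma>\<^esub>}. g [^]\<^bsub>\<Gamma>\<^esub> circuit_det \<delta> \<gamma> es Cs T \<noteq> \<one>\<^bsub>\<Gamma>\<^esub>)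
         \<longleftrightarrow> circuit_generator \<Gamma> G \<B>"
proof -
  interpret \<Gamma>: comm_group \<Gamma> by fact
  have "pair_graph T" using assms(11) by (simp add: undirected_spanning_tree_def)
  then interpret cyclomatic_circuits G T \<delta> \<gamma> es Cs
    using assms unfolding cyclomatic_circuits_def cyclomatic_circuits_axioms_def by simp
  have "g [^]\<^bsub>\<Gamma>\<^esub> circuit_det \<delta> \<gamma> es Cs T = \<one>\<^bsub>\<Gamma>\<^esub> \<longleftrightarrow> g [^]\<^bsub>\<Gamma>\<^esub> Determinant.det chord_matrix = \<one>\<^bsub>\<Gamma>\<^esub>"
    if "g \<in> carrier \<Gamma>" for g
    using that by (simp add: \<Gamma>.pow_eq_id \<Gamma>.int_pow_eq_id circuit_det_eq flip: int_dvd_int_iff)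
  then show ?thesis
    using circuit_generator_if_no_det_torsion[OF assms(1)]
      not_circuit_generator_if_det_torsion[OF assms(1)] assms(10) by auto
qed

end
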